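(* Let $G$ be a finite commutative group and let $m=p_1^{r_1}p_2^{r_2}\cdots p_j^{r_j}$ be the prime factorization of the integer $m\geq 2$. Set $k=\max\{r_1,r_2,\ldots,r_j\}$, $c_i=(p_1p_2\cdots p_j)/p_i$, and let $t_i$ be a natural number such that $t_ic_i\equiv 1 \pmod{p_i}$ for $i=1,2,\dots,j$. If $\bar{f_i}$ is an idempotent element of the group ring $\mathbb{Z}_{p_i}G$ for $i=1,2,\dots,j$, then $$e=\left[t_1c_1f_1+t_2c_2f_2+\cdots+t_jc_jf_j\right]^{(p_1p_2\cdots p_j)^{k-1}}$$ is an idempotent element of the group ring $\mathbb{Z}_{m}G$. Moreover, $$|E(\mathbb{Z}_{m}G)|=|E(\mathbb{Z}_{p_1p_2\cdots p_j}G)|.$$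
   Context: $\mathbb{Z}_n$ denotes the ring of integers modulo $n$ and $\mathbb{Z}_nG$ the group ring of $G$ over $\mathbb{Z}_n$. For a commutative ring $A$, $E(A)=\{e\in A : e^2=e\}$ denotes its set of idempotent elements, and $|X|$ denotes the cardinality of a set $X$. In the prime factorization the $p_i$ are distinct primes and $r_i\ge 1$. For each $i$, $f_i$ denotes a representative of $\bar{f_i}$ with integer coefficients (an element of $\mathbb{Z}G$ whose reduction modulo $p_i$ is $\bar{f_i}$), and the expression for $e$ is read in $\mathbb{Z}_mG$ by reducing coefficients modulo $m$. *)

theory Defs
  imports
    "HOL-Number_Theory.Residues"
    "HOL-Algebra.IntRing"
begin

text \<open>
  The group ring \<open>R G\<close>: an element is the family of its coefficients, a finitely supported function
  from the carrier of \<open>G\<close> to the carrier of \<open>R\<close> (\<open>undefined\<close> off the carrier of \<open>G\<close>, so that equality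
  of elements is equality of functions). The coefficient of \<open>g\<close> in a product \<open>a b\<close> is the sum of
  \<open>a(x) b(y)\<close> over all \<open>x y = g\<close>; it is indexed by the support of \<open>a\<close>, because \<open>finsum\<close> over an
  infinite set is zero.
\<close>

definition group_ring :: "('r, 's) ring_scheme \<Rightarrow> ('g, 'h) monoid_scheme \<Rightarrow> ('g \<Rightarrow> 'r) ring" where
  "group_ring R G =
    \<lparr>carrier = {a \<in> carrier G \<rightarrow>\<^sub>E carrier R. finite {g \<in> carrier G. a g \<noteq> \<zero>\<^bsub>R\<^esub>}},
     monoid.mult = (\<lambda>a b. \<lambda>g\<in>carrier G.
       (\<Oplus>\<^bsub>R\<^esub>x\<in>{x \<in> carrier G. a x \<noteq> \<zero>\<^bsub>R\<^esub>}. a x \<otimes>\<^bsub>R\<^esub> b (inv\<^bsub>G\<^esub> x \<otimes>\<^bsub>G\<^esub> g))),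
     one = (\<lambda>g\<in>carrier G. if g = \<one>\<^bsub>G\<^esub> then \<one>\<^bsub>R\<^esub> else \<zero>\<^bsub>R\<^esub>),
     zero = (\<lambda>g\<in>carrier G. \<zero>\<^bsub>R\<^esub>),
     add = (\<lambda>a b. \<lambda>g\<in>carrier G. a g \<oplus>\<^bsub>R\<^esub> b g)\<rparr>"

abbreviation Zn_group_ring :: "nat \<Rightarrow> ('g, 'h) monoid_scheme \<Rightarrow> ('g \<Rightarrow> int) ring" where
  "Zn_group_ring n G \<equiv> group_ring (residue_ring (int n)) G"

text \<open>
  Reduction of coefficients modulo \<open>n\<close>, from the integral group ring of \<open>G\<close> to \<open>Zn_group_ring n G\<close>;
  the elements of \<open>residue_ring (int n)\<close> are the integers from \<open>0\<close> to \<open>n - 1\<close>.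
\<close>

definition reduce_coeffs :: "('g, 'h) monoid_scheme \<Rightarrow> nat \<Rightarrow> ('g \<Rightarrow> int) \<Rightarrow> 'g \<Rightarrow> int" where
  "reduce_coeffs G n a = (\<lambda>g\<in>carrier G. a g mod int n)"

definition idempotents :: "('a, 'b) ring_scheme \<Rightarrow> 'a set" where
  "idempotents A = {e \<in> carrier A. e \<otimes>\<^bsub>A\<^esub> e = e}"

end

theory Submission
  imports Defs
begin

text \<open>
  The theorem rests on one fact about a commutative ring: raising to the power \<open>P\<close> sharpens a
  congruence. If \<open>x\<close> and \<open>y\<close> are congruent modulo a multiple \<open>n\<close> of \<open>P\<close>, the binomial expansion of
  \<open>x\<^sup>P = (y + n u)\<^sup>P\<close> begins \<open>y\<^sup>P + P n u y\<^sup>P\<^sup>-\<^sup>1\<close> and all its other terms are divisible by \<open>n\<^sup>2\<close>,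
  hence \<open>x\<^sup>P\<close> and \<open>y\<^sup>P\<close> are congruent modulo \<open>P n\<close> (\<open>ring_cong_pow\<close>). Starting from a congruence
  modulo \<open>P\<close> and iterating, the powers with exponent \<open>P ^ s\<close> are congruent modulo \<open>P ^ Suc s\<close>
  (\<open>ring_cong_pow_power\<close>). The number \<open>P\<close> may be composite, which is why the product of
  all the primes can be treated in one go.

  All computations take place in the integral group ring of \<open>G\<close>, where an element represents an
  idempotent modulo \<open>n\<close> iff it is congruent to its square modulo \<open>n\<close>. Let \<open>P\<close> be the product of the
  primes dividing \<open>m\<close>, so that \<open>P\<close> divides \<open>m\<close> and \<open>m\<close> divides \<open>P ^ k\<close>.

  The element \<open>S = t\<^sub>1 c\<^sub>1 f\<^sub>1 + \<dots>\<close> is congruent to \<open>f\<^sub>i\<close> modulo each \<open>p\<^sub>i\<close>, hence congruent to its square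
  modulo each \<open>p\<^sub>i\<close> and, by coprimality, modulo \<open>P\<close> (\<open>glued_idempotent\<close>). Applying the sharpening
  to \<open>S\<^sup>2\<close> and \<open>S\<close> shows that \<open>S ^ (P ^ (k - 1))\<close> is congruent to its square modulo \<open>P ^ k\<close> and
  therefore modulo \<open>m\<close> (\<open>pow_lifts_idempotent\<close>).

  For the cardinalities, reduction modulo \<open>P\<close> is a bijection between the two sets of idempotents
  (\<open>bij_betw_idempotents\<close>). It is surjective because taking the power with exponent \<open>P ^ (k - 1)\<close>
  lifts an idempotent and, modulo \<open>P\<close>, leaves it unchanged. It is injective because
  idempotents equal their own powers, so that two of them which agree modulo \<open>P\<close> agree modulo \<open>m\<close>
  by the sharpening.
\<close>

section \<open>Powers of congruent elements in a commutative ring\<close>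

text \<open>
  Congruence modulo the ideal \<open>n R\<close>. The quotient \<open>z\<close> is a witness rather than an element of a
  factor ring, since the lemmas on powers expand \<open>y \<oplus> n z\<close>.
\<close>

definition ring_cong :: "('a, 'b) ring_scheme \<Rightarrow> nat \<Rightarrow> 'a \<Rightarrow> 'a \<Rightarrow> bool" where
  "ring_cong R n x y \<longleftrightarrow> (\<exists>z\<in>carrier R. x = y \<oplus>\<^bsub>R\<^esub> [n] \<cdot>\<^bsub>R\<^esub> z)"

context cring
begin

text \<open>
  The binomial theorem up to first order in \<open>z\<close>; the higher terms only matter through their common
  factor \<open>z\<^sup>2\<close>, so no binomial coefficients have to be tracked. The exponent is a successor to
  keep \<open>q\<close>, the exponent of \<open>y\<close> in the linear term, free of truncated subtraction.
\<close>

lemma pow_add_first_order: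
  assumes y: "y \<in> carrier R" and z: "z \<in> carrier R"
  shows "\<exists>w\<in>carrier R. (y \<oplus> z) [^] Suc q
           = y [^] Suc q \<oplus> ([Suc q] \<cdot> (z \<otimes> y [^] q) \<oplus> z \<otimes> z \<otimes> w)"
proof (induction q)
  case 0
  show ?case
    by (rule bexI[of _ "\<zero>"]) (use y z in \<open>simp_all add: a_ac\<close>)
next
  case (Suc q)
  then obtain w where w: "w \<in> carrier R"
    and IH: "(y \<oplus> z) [^] Suc q = y [^] Suc q \<oplus> ([Suc q] \<cdot> (z \<otimes> y [^] q) \<oplus> z \<otimes> z \<otimes> w)"
    by blast
  \<comment> \<open>Hiding the integer multiple in \<open>c\<close> leaves a pure ring identity for the simplifier.\<close>
  define c where "c = [Suc q] \<cdot> (y [^] q)"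
  have c: "c \<in> carrier R" and p: "y [^] q \<in> carrier R"
    using y by (simp_all add: c_def)
  have zc: "[Suc q] \<cdot> (z \<otimes> y [^] q) = z \<otimes> c"
    using y z by (simp only: c_def add_pow_rdistr nat_pow_closed)
  have yc: "[Suc q] \<cdot> (z \<otimes> y [^] Suc q) = z \<otimes> (c \<otimes> y)"
    using y z by (simp only: c_def add_pow_rdistr add_pow_ldistr nat_pow_closed nat_pow_Suc m_closed)
  have "(y \<oplus> z) [^] Suc (Suc q) = (y [^] Suc q \<oplus> (z \<otimes> c \<oplus> z \<otimes> z \<otimes> w)) \<otimes> (y \<oplus> z)"
    using IH zc by (simp only: nat_pow_Suc)
  also have "\<dots> = y [^] Suc (Suc q) \<oplus> ((z \<otimes> (c \<otimes> y) \<oplus> z \<otimes> y [^] Suc q)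
               \<oplus> z \<otimes> z \<otimes> (w \<otimes> y \<oplus> c \<oplus> w \<otimes> z))"
    using y z w c p by (simp add: l_distr r_distr a_ac m_ac)
  also have "z \<otimes> (c \<otimes> y) \<oplus> z \<otimes> y [^] Suc q = [Suc (Suc q)] \<cdot> (z \<otimes> y [^] Suc q)"
    using y z by (simp only: yc[symmetric] add.nat_pow_Suc)
  finally show ?case
    using y z w c by blast
qed

text \<open>
  Both the linear term, which carries the factor \<open>P\<close> coming from the derivative, and the quadratic
  remainder, which carries \<open>n\<^sup>2\<close> and hence \<open>P n\<close>, vanish modulo \<open>P n\<close>.
\<close>

lemma ring_cong_pow:
  assumes "P dvd n" "ring_cong R n x y" and y: "y \<in> carrier R"
  shows "ring_cong R (P * n) (x [^] P) (y [^] P)"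
proof (cases P)
  case 0
  then show ?thesis
    by (auto simp: ring_cong_def intro!: bexI[of _ "\<zero>"])
next
  case (Suc q)
  obtain u where u: "u \<in> carrier R" and x: "x = y \<oplus> [n] \<cdot> u"
    using assms(2) by (auto simp: ring_cong_def)
  obtain c where c: "n = P * c" using assms(1) by blast
  have nu: "[n] \<cdot> u \<in> carrier R" using u by simp
  obtain w where w: "w \<in> carrier R"
    and e: "x [^] P = y [^] P \<oplus> ([P] \<cdot> (([n] \<cdot> u) \<otimes> y [^] q) \<oplus> ([n] \<cdot> u) \<otimes> ([n] \<cdot> u) \<otimes> w)"
    using pow_add_first_order[OF y nu, of q] unfolding x Suc by blast
  have "[P] \<cdot> (([n] \<cdot> u) \<otimes> y [^] q) = [(P * n)] \<cdot> (u \<otimes> y [^] q)"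
    using u y by (simp add: add_pow_ldistr add.nat_pow_pow mult.commute)
  moreover have "([n] \<cdot> u) \<otimes> ([n] \<cdot> u) \<otimes> w = [(P * n)] \<cdot> ([c] \<cdot> (u \<otimes> u \<otimes> w))"
    using u w by (simp add: add_pow_ldistr add_pow_rdistr add.nat_pow_pow c mult_ac)
  ultimately have "x [^] P = y [^] P \<oplus> [(P * n)] \<cdot> (u \<otimes> y [^] q \<oplus> [c] \<cdot> (u \<otimes> u \<otimes> w))"
    using e u y w by (simp add: add.nat_pow_distrib)
  then show ?thesis
    using u y w by (auto simp: ring_cong_def)
qed

lemma ring_cong_pow_power:
  assumes "ring_cong R P x y" and x: "x \<in> carrier R" and y: "y \<in> carrier R"
  shows "ring_cong R (P ^ Suc s) (x [^] (P ^ s)) (y [^] (P ^ s))"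
proof (induction s)
  case 0
  then show ?case using assms by simp
next
  case (Suc s)
  have "ring_cong R (P * P ^ Suc s) ((x [^] (P ^ s)) [^] P) ((y [^] (P ^ s)) [^] P)"
    using Suc y by (intro ring_cong_pow) auto
  then show ?case
    using x y by (simp add: nat_pow_pow mult_ac)
qed

end

section \<open>Finite sums and translations of a group\<close>

lemma (in abelian_monoid) finsum_swap:
  assumes "finite A" "finite B" "\<And>x y. x \<in> A \<Longrightarrow> y \<in> B \<Longrightarrow> f x y \<in> carrier G"
  shows "(\<Oplus>x\<in>A. \<Oplus>y\<in>B. f x y) = (\<Oplus>y\<in>B. \<Oplus>x\<in>A. f x y)"
  using assms(1,3)
proof (induction A rule: finite_induct)
  case empty
  then show ?case by simp
next
  case (insert a A)
  have "(\<Oplus>x\<in>insert a A. \<Oplus>y\<in>B. f x y) = (\<Oplus>y\<in>B. f a y) \<oplus> (\<Oplus>y\<in>B. \<Oplus>x\<in>A. f x y)"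
    using insert by (subst finsum_insert) (auto intro!: finsum_closed)
  also have "\<dots> = (\<Oplus>y\<in>B. f a y \<oplus> (\<Oplus>x\<in>A. f x y))"
    using insert by (intro finsum_addf[symmetric]) (auto intro!: finsum_closed)
  also have "\<dots> = (\<Oplus>y\<in>B. \<Oplus>x\<in>insert a A. f x y)"
    using insert by (intro finsum_cong') (auto intro!: finsum_closed)
  finally show ?case .
qed

lemma (in group) bij_betw_left_translate:
  assumes "x \<in> carrier G"
  shows "bij_betw (\<lambda>y. x \<otimes> y) (carrier G) (carrier G)"
  by (rule bij_betw_byWitness[of _ "\<lambda>y. inv x \<otimes> y"])
     (use assms in \<open>auto simp: m_assoc[symmetric]\<close>)

lemma (in comm_group) bij_betw_inv_mult:
  assumes "g \<in> carrier G"
  shows "bij_betw (\<lambda>x. inv x \<otimes> g) (carrier G) (carrier G)"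
  by (rule bij_betw_byWitness[of _ "\<lambda>x. inv x \<otimes> g"])
     (use assms in \<open>auto simp: inv_mult m_assoc\<close>)

section \<open>The group ring of a finite commutative group\<close>

locale finite_comm_group_ring = R: cring R + G: comm_group G
  for R :: "('r, 's) ring_scheme" (structure) and G :: "('g, 'h) monoid_scheme" +
  assumes finite_G: "finite (carrier G)"
begin

abbreviation "RG \<equiv> group_ring R G"

lemma carrier_group_ring: "carrier RG = carrier G \<rightarrow>\<^sub>E carrier R"
  using finite_G by (auto simp: group_ring_def)

lemma coeff_closed: "a \<in> carrier RG \<Longrightarrow> g \<in> carrier G \<Longrightarrow> a g \<in> carrier R"
  by (auto simp: carrier_group_ring)

lemma group_ring_eqI:
  "a \<in> carrier RG \<Longrightarrow> b \<in> carrier RG \<Longrightarrow> (\<And>g. g \<in> carrier G \<Longrightarrow> a g = b g) \<Longrightarrow> a = b"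
  by (auto simp: carrier_group_ring intro: PiE_ext)

lemma group_ring_add: "g \<in> carrier G \<Longrightarrow> (a \<oplus>\<^bsub>RG\<^esub> b) g = a g \<oplus> b g"
  and group_ring_zero: "g \<in> carrier G \<Longrightarrow> \<zero>\<^bsub>RG\<^esub> g = \<zero>"
  and group_ring_one: "g \<in> carrier G \<Longrightarrow> \<one>\<^bsub>RG\<^esub> g = (if g = \<one>\<^bsub>G\<^esub> then \<one> else \<zero>)"
  by (simp_all add: group_ring_def)

text \<open>
  Over a finite group the sum may run over the whole group instead of the support of \<open>a\<close>. Its index
  set then no longer depends on \<open>a\<close>, which the reindexing and swapping of sums below require.
\<close>

lemma group_ring_mult:
  assumes "a \<in> carrier RG" "b \<in> carrier RG" "g \<in> carrier G"
  shows "(a \<otimes>\<^bsub>RG\<^esub> b) g = (\<Oplus>x\<in>carrier G. a x \<otimes> b (inv\<^bsub>G\<^esub> x \<otimes>\<^bsub>G\<^esub> g))"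
proof -
  have "(a \<otimes>\<^bsub>RG\<^esub> b) g = (\<Oplus>x\<in>{x \<in> carrier G. a x \<noteq> \<zero>}. a x \<otimes> b (inv\<^bsub>G\<^esub> x \<otimes>\<^bsub>G\<^esub> g))"
    using assms by (simp add: group_ring_def)
  also have "\<dots> = (\<Oplus>x\<in>carrier G. a x \<otimes> b (inv\<^bsub>G\<^esub> x \<otimes>\<^bsub>G\<^esub> g))"
    using assms finite_G
    by (intro R.add.finprod_mono_neutral_cong_left) (auto simp: coeff_closed)
  finally show ?thesis .
qed

lemma group_ring_closed:
  assumes "a \<in> carrier RG" "b \<in> carrier RG"
  shows "a \<oplus>\<^bsub>RG\<^esub> b \<in> carrier RG" "a \<otimes>\<^bsub>RG\<^esub> b \<in> carrier RG"
proof -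
  show "a \<oplus>\<^bsub>RG\<^esub> b \<in> carrier RG"
    using assms unfolding carrier_group_ring by (auto simp: group_ring_def)
  have "(a \<otimes>\<^bsub>RG\<^esub> b) g \<in> carrier R" if "g \<in> carrier G" for g
    using assms that by (simp add: group_ring_mult coeff_closed)
  moreover have "(a \<otimes>\<^bsub>RG\<^esub> b) g = undefined" if "g \<notin> carrier G" for g
    using that by (simp add: group_ring_def)
  ultimately show "a \<otimes>\<^bsub>RG\<^esub> b \<in> carrier RG"
    unfolding carrier_group_ring by (intro PiE_I) auto
qed

lemma group_ring_zero_one_closed: "\<zero>\<^bsub>RG\<^esub> \<in> carrier RG" "\<one>\<^bsub>RG\<^esub> \<in> carrier RG"
  unfolding carrier_group_ring by (auto simp: group_ring_def)

text \<open>
  The substitution \<open>x \<mapsto> x\<^sup>-\<^sup>1 g\<close> exchanges the two factors of \<open>g = x (x\<^sup>-\<^sup>1 g)\<close>.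
\<close>

lemma group_ring_mult_comm:
  assumes "a \<in> carrier RG" "b \<in> carrier RG"
  shows "a \<otimes>\<^bsub>RG\<^esub> b = b \<otimes>\<^bsub>RG\<^esub> a"
proof (rule group_ring_eqI)
  fix g assume g: "g \<in> carrier G"
  let ?h = "\<lambda>x. inv\<^bsub>G\<^esub> x \<otimes>\<^bsub>G\<^esub> g"
  have h: "bij_betw ?h (carrier G) (carrier G)"
    using g by (rule G.bij_betw_inv_mult)
  have "(\<Oplus>x\<in>?h ` carrier G. b x \<otimes> a (?h x)) = (\<Oplus>x\<in>carrier G. b (?h x) \<otimes> a (?h (?h x)))"
    using h assms g
    by (intro R.add.finprod_reindex) (auto simp: bij_betw_def coeff_closed)
  then have "(b \<otimes>\<^bsub>RG\<^esub> a) g = (\<Oplus>x\<in>carrier G. b (?h x) \<otimes> a (?h (?h x)))"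
    using h assms g by (simp add: bij_betw_def group_ring_mult)
  also have "\<dots> = (\<Oplus>x\<in>carrier G. a x \<otimes> b (?h x))"
    using assms g
    by (intro R.finsum_cong') (auto simp: coeff_closed G.inv_mult G.m_assoc R.m_comm)
  finally show "(a \<otimes>\<^bsub>RG\<^esub> b) g = (b \<otimes>\<^bsub>RG\<^esub> a) g"
    using assms g by (simp add: group_ring_mult)
qed (use assms in \<open>auto intro: group_ring_closed\<close>)

text \<open>
  Both sides sum \<open>a(x) b(z) c(w)\<close> over the triples with \<open>x z w = g\<close>: after exchanging the sums,
  \<open>y = x z\<close> turns the left-hand side into the right-hand side.
\<close>

lemma group_ring_mult_assoc:
  assumes a: "a \<in> carrier RG" and b: "b \<in> carrier RG" and c: "c \<in> carrier RG"
  shows "(a \<otimes>\<^bsub>RG\<^esub> b) \<otimes>\<^bsub>RG\<^esub> c = a \<otimes>\<^bsub>RG\<^esub> (b \<otimes>\<^bsub>RG\<^esub> c)"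
proof (rule group_ring_eqI)
  fix g assume g: "g \<in> carrier G"
  note cl = coeff_closed[OF a] coeff_closed[OF b] coeff_closed[OF c]
  have "((a \<otimes>\<^bsub>RG\<^esub> b) \<otimes>\<^bsub>RG\<^esub> c) g
      = (\<Oplus>y\<in>carrier G. (\<Oplus>x\<in>carrier G. a x \<otimes> b (inv\<^bsub>G\<^esub> x \<otimes>\<^bsub>G\<^esub> y)) \<otimes> c (inv\<^bsub>G\<^esub> y \<otimes>\<^bsub>G\<^esub> g))"
    using a b c g group_ring_closed
    by (subst group_ring_mult) (auto intro!: R.finsum_cong' simp: group_ring_mult cl)
  also have "\<dots> = (\<Oplus>y\<in>carrier G. \<Oplus>x\<in>carrier G.
                   a x \<otimes> b (inv\<^bsub>G\<^esub> x \<otimes>\<^bsub>G\<^esub> y) \<otimes> c (inv\<^bsub>G\<^esub> y \<otimes>\<^bsub>G\<^esub> g))"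
    using g finite_G by (intro R.finsum_cong') (auto simp: cl intro!: R.finsum_ldistr)
  also have "\<dots> = (\<Oplus>x\<in>carrier G. \<Oplus>y\<in>carrier G.
                   a x \<otimes> b (inv\<^bsub>G\<^esub> x \<otimes>\<^bsub>G\<^esub> y) \<otimes> c (inv\<^bsub>G\<^esub> y \<otimes>\<^bsub>G\<^esub> g))"
    using g finite_G by (intro R.finsum_swap) (auto simp: cl)
  also have "\<dots> = (\<Oplus>x\<in>carrier G. a x \<otimes> (b \<otimes>\<^bsub>RG\<^esub> c) (inv\<^bsub>G\<^esub> x \<otimes>\<^bsub>G\<^esub> g))"
  proof (intro R.finsum_cong' refl)
    fix x assume x: "x \<in> carrier G"
    have "(\<Oplus>y\<in>(\<lambda>z. x \<otimes>\<^bsub>G\<^esub> z) ` carrier G.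
             a x \<otimes> b (inv\<^bsub>G\<^esub> x \<otimes>\<^bsub>G\<^esub> y) \<otimes> c (inv\<^bsub>G\<^esub> y \<otimes>\<^bsub>G\<^esub> g))
        = (\<Oplus>z\<in>carrier G. a x \<otimes> b (inv\<^bsub>G\<^esub> x \<otimes>\<^bsub>G\<^esub> (x \<otimes>\<^bsub>G\<^esub> z)) \<otimes> c (inv\<^bsub>G\<^esub> (x \<otimes>\<^bsub>G\<^esub> z) \<otimes>\<^bsub>G\<^esub> g))"
      using G.bij_betw_left_translate[OF x] x g
      by (intro R.add.finprod_reindex) (auto simp: bij_betw_def cl)
    also have "\<dots> = (\<Oplus>z\<in>carrier G. a x \<otimes> (b z \<otimes> c (inv\<^bsub>G\<^esub> z \<otimes>\<^bsub>G\<^esub> (inv\<^bsub>G\<^esub> x \<otimes>\<^bsub>G\<^esub> g))))"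
      using x g
      by (intro R.finsum_cong')
         (auto simp: cl R.m_assoc G.inv_mult_group G.m_assoc simp flip: G.m_assoc[of "inv\<^bsub>G\<^esub> x" x])
    also have "\<dots> = a x \<otimes> (b \<otimes>\<^bsub>RG\<^esub> c) (inv\<^bsub>G\<^esub> x \<otimes>\<^bsub>G\<^esub> g)"
      using x g b c finite_G
      by (simp add: group_ring_mult) (intro R.finsum_rdistr[symmetric], auto simp: cl)
    finally show "(\<Oplus>y\<in>carrier G. a x \<otimes> b (inv\<^bsub>G\<^esub> x \<otimes>\<^bsub>G\<^esub> y) \<otimes> c (inv\<^bsub>G\<^esub> y \<otimes>\<^bsub>G\<^esub> g))
        = a x \<otimes> (b \<otimes>\<^bsub>RG\<^esub> c) (inv\<^bsub>G\<^esub> x \<otimes>\<^bsub>G\<^esub> g)"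
      using G.bij_betw_left_translate[OF x] by (simp add: bij_betw_def)
  qed (use g b c in \<open>auto intro!: Pi_I R.m_closed cl coeff_closed[OF group_ring_closed(2)]\<close>)
  also have "\<dots> = (a \<otimes>\<^bsub>RG\<^esub> (b \<otimes>\<^bsub>RG\<^esub> c)) g"
    using a b c g group_ring_closed by (simp add: group_ring_mult)
  finally show "((a \<otimes>\<^bsub>RG\<^esub> b) \<otimes>\<^bsub>RG\<^esub> c) g = (a \<otimes>\<^bsub>RG\<^esub> (b \<otimes>\<^bsub>RG\<^esub> c)) g" .
qed (use assms in \<open>auto intro!: group_ring_closed\<close>)

lemma group_ring_one_mult:
  assumes a: "a \<in> carrier RG"
  shows "\<one>\<^bsub>RG\<^esub> \<otimes>\<^bsub>RG\<^esub> a = a"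
proof (rule group_ring_eqI)
  fix g assume g: "g \<in> carrier G"
  have "(\<one>\<^bsub>RG\<^esub> \<otimes>\<^bsub>RG\<^esub> a) g = (\<Oplus>x\<in>carrier G. if \<one>\<^bsub>G\<^esub> = x then a (inv\<^bsub>G\<^esub> x \<otimes>\<^bsub>G\<^esub> g) else \<zero>)"
    using a g group_ring_zero_one_closed
    by (subst group_ring_mult) (auto intro!: R.finsum_cong' simp: group_ring_one coeff_closed)
  also have "\<dots> = a g"
    using a g finite_G by (subst R.add.finprod_singleton) (auto simp: coeff_closed)
  finally show "(\<one>\<^bsub>RG\<^esub> \<otimes>\<^bsub>RG\<^esub> a) g = a g" .
qed (use assms group_ring_closed group_ring_zero_one_closed in auto)

lemma group_ring_distrib:
  assumes "a \<in> carrier RG" "b \<in> carrier RG" "c \<in> carrier RG"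
  shows "(a \<oplus>\<^bsub>RG\<^esub> b) \<otimes>\<^bsub>RG\<^esub> c = a \<otimes>\<^bsub>RG\<^esub> c \<oplus>\<^bsub>RG\<^esub> b \<otimes>\<^bsub>RG\<^esub> c"
proof (rule group_ring_eqI)
  fix g assume g: "g \<in> carrier G"
  have "((a \<oplus>\<^bsub>RG\<^esub> b) \<otimes>\<^bsub>RG\<^esub> c) g
      = (\<Oplus>x\<in>carrier G. a x \<otimes> c (inv\<^bsub>G\<^esub> x \<otimes>\<^bsub>G\<^esub> g) \<oplus> b x \<otimes> c (inv\<^bsub>G\<^esub> x \<otimes>\<^bsub>G\<^esub> g))"
    unfolding group_ring_mult[OF group_ring_closed(1)[OF assms(1,2)] assms(3) g]
    using assms g
    by (intro R.finsum_cong') (auto simp: group_ring_add coeff_closed R.l_distr)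
  also have "\<dots> = (a \<otimes>\<^bsub>RG\<^esub> c \<oplus>\<^bsub>RG\<^esub> b \<otimes>\<^bsub>RG\<^esub> c) g"
    using assms g
    by (simp add: group_ring_add group_ring_mult) (intro R.finsum_addf, auto simp: coeff_closed)
  finally show "((a \<oplus>\<^bsub>RG\<^esub> b) \<otimes>\<^bsub>RG\<^esub> c) g = (a \<otimes>\<^bsub>RG\<^esub> c \<oplus>\<^bsub>RG\<^esub> b \<otimes>\<^bsub>RG\<^esub> c) g" .
qed (use assms in \<open>auto intro!: group_ring_closed\<close>)

lemma cring_group_ring: "cring RG"
proof (rule cringI)
  show "abelian_group RG"
  proof (rule abelian_groupI)
    fix a assume a: "a \<in> carrier RG"
    show "\<exists>b\<in>carrier RG. b \<oplus>\<^bsub>RG\<^esub> a = \<zero>\<^bsub>RG\<^esub>"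
    proof (intro bexI group_ring_eqI)
      show "(\<lambda>g\<in>carrier G. \<ominus> a g) \<in> carrier RG"
        using a by (auto simp: carrier_group_ring)
      then show "(\<lambda>g\<in>carrier G. \<ominus> a g) \<oplus>\<^bsub>RG\<^esub> a \<in> carrier RG"
        using a by (rule group_ring_closed)
    qed (use a in \<open>auto simp: group_ring_add group_ring_zero coeff_closed R.l_neg
                          group_ring_zero_one_closed\<close>)
  qed (auto intro!: group_ring_eqI group_ring_closed group_ring_zero_one_closed
         simp: group_ring_add group_ring_zero coeff_closed R.a_ac)
  show "comm_monoid RG"
    by (rule comm_monoidI)
       (blast intro: group_ring_closed group_ring_zero_one_closed group_ring_mult_assoc
          group_ring_one_mult group_ring_mult_comm)+
qed (rule group_ring_distrib)

end

section \<open>The integral group ring and its reductions\<close>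

lemma (in monoid) idempotent_nat_pow:
  assumes "x \<in> carrier G" "x \<otimes> x = x" "n > 0"
  shows "x [^] (n::nat) = x"
  using assms(3)
proof (induction n rule: nat_induct_non_zero)
  case (Suc n)
  then show ?case using assms by simp
qed (use assms in simp)

locale finite_comm_group = comm_group G for G (structure) +
  assumes finite_carrier: "finite (carrier G)"
begin

abbreviation ZG ("\<int>G")
  where "\<int>G \<equiv> group_ring \<Z> G"

lemma finite_comm_group_ring: "cring R \<Longrightarrow> finite_comm_group_ring R G"
  by (simp add: finite_comm_group_ring_def finite_comm_group_ring_axioms_def
        comm_group_axioms finite_carrier)

lemma residue_ring_finite_comm_group_ring:
  assumes "n > 1"
  shows "finite_comm_group_ring (residue_ring (int n)) G"
proof (rule finite_comm_group_ring)
  interpret residues "int n" "residue_ring (int n)"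
    by unfold_locales (use assms in simp_all)
  show "cring (residue_ring (int n))" by (rule cring)
qed

sublocale Z: finite_comm_group_ring \<Z> G
  by (rule finite_comm_group_ring[OF int_is_cring])

sublocale ZG: cring "\<int>G"
  by (rule Z.cring_group_ring)

lemma ZG_carrier: "carrier \<int>G = extensional (carrier G)"
  by (simp add: Z.carrier_group_ring PiE_def)

lemma ZG_add_coeff: "g \<in> carrier G \<Longrightarrow> (a \<oplus>\<^bsub>\<int>G\<^esub> b) g = a g + b g"
  by (simp add: Z.group_ring_add)

lemma ZG_mult_coeff:
  assumes "a \<in> carrier \<int>G" "b \<in> carrier \<int>G" "g \<in> carrier G"
  shows "(a \<otimes>\<^bsub>\<int>G\<^esub> b) g = (\<Sum>x\<in>carrier G. a x * b (inv x \<otimes> g))"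
  using Z.group_ring_mult[OF assms] by simp

lemma ZG_add_pow_coeff: "g \<in> carrier G \<Longrightarrow> ([(n::nat)] \<cdot>\<^bsub>\<int>G\<^esub> a) g = int n * a g"
  by (induction n) (simp_all add: Z.group_ring_zero ZG_add_coeff algebra_simps)

lemma ZG_finsum_coeff:
  assumes "g \<in> carrier G" "\<And>i. i \<in> I \<Longrightarrow> f i \<in> carrier \<int>G"
  shows "(\<Oplus>\<^bsub>\<int>G\<^esub>i\<in>I. f i) g = (\<Sum>i\<in>I. f i g)"
  using assms(2)
  by (induction I rule: infinite_finite_induct)
     (use assms(1) in \<open>auto simp: Z.group_ring_zero ZG_add_coeff Pi_def\<close>)

lemma reduce_coeffs_eq_iff:
  "reduce_coeffs G n a = reduce_coeffs G n b \<longleftrightarrow> (\<forall>g\<in>carrier G. [a g = b g] (mod int n))"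
  by (auto simp: reduce_coeffs_def fun_eq_iff cong_def)

lemma reduce_coeffs_eq_iff_ring_cong:
  assumes a: "a \<in> carrier \<int>G" and b: "b \<in> carrier \<int>G"
  shows "reduce_coeffs G n a = reduce_coeffs G n b \<longleftrightarrow> ring_cong \<int>G n a b"
proof
  assume eq: "reduce_coeffs G n a = reduce_coeffs G n b"
  define z where "z = (\<lambda>g\<in>carrier G. (a g - b g) div int n)"
  have z: "z \<in> carrier \<int>G" by (simp add: ZG_carrier z_def)
  have "a = b \<oplus>\<^bsub>\<int>G\<^esub> [n] \<cdot>\<^bsub>\<int>G\<^esub> z"
  proof (rule Z.group_ring_eqI[OF a])
    fix g assume g: "g \<in> carrier G"
    have "int n dvd a g - b g"
      using eq g by (simp add: reduce_coeffs_eq_iff cong_iff_dvd_diff)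
    then show "a g = (b \<oplus>\<^bsub>\<int>G\<^esub> [n] \<cdot>\<^bsub>\<int>G\<^esub> z) g"
      using g by (simp add: ZG_add_coeff ZG_add_pow_coeff z_def)
  qed (use b z in simp)
  then show "ring_cong \<int>G n a b" using z by (auto simp: ring_cong_def)
next
  assume "ring_cong \<int>G n a b"
  then show "reduce_coeffs G n a = reduce_coeffs G n b"
    by (auto simp: ring_cong_def reduce_coeffs_eq_iff ZG_add_coeff ZG_add_pow_coeff
          cong_iff_dvd_diff)
qed

text \<open>
  Since the kernel of reduction modulo \<open>n\<close> is the ideal generated by \<open>n\<close>, the sharpening of
  congruences becomes a statement about reductions.
\<close>

lemma reduce_coeffs_eq_pow:
  assumes "reduce_coeffs G P a = reduce_coeffs G P b" "n dvd P ^ Suc s"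
    and a: "a \<in> carrier \<int>G" and b: "b \<in> carrier \<int>G"
  shows "reduce_coeffs G n (a [^]\<^bsub>\<int>G\<^esub> (P ^ s)) = reduce_coeffs G n (b [^]\<^bsub>\<int>G\<^esub> (P ^ s))"
proof -
  have "ring_cong \<int>G (P ^ Suc s) (a [^]\<^bsub>\<int>G\<^esub> (P ^ s)) (b [^]\<^bsub>\<int>G\<^esub> (P ^ s))"
    using assms by (intro ZG.ring_cong_pow_power) (simp_all add: reduce_coeffs_eq_iff_ring_cong)
  then have "reduce_coeffs G (P ^ Suc s) (a [^]\<^bsub>\<int>G\<^esub> (P ^ s))
           = reduce_coeffs G (P ^ Suc s) (b [^]\<^bsub>\<int>G\<^esub> (P ^ s))"
    using a b by (simp add: reduce_coeffs_eq_iff_ring_cong)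
  moreover have "int n dvd int (P ^ Suc s)" using assms(2) by (simp only: int_dvd_int_iff)
  ultimately show ?thesis
    unfolding reduce_coeffs_eq_iff by (blast intro: cong_dvd_modulus)
qed

lemma reduce_coeffs_ring_hom:
  assumes n: "n > 1"
  shows "ring_hom_cring \<int>G (Zn_group_ring n G) (reduce_coeffs G n)"
proof -
  interpret N: residues "int n" "residue_ring (int n)"
    by unfold_locales (use n in simp_all)
  interpret NG: finite_comm_group_ring "residue_ring (int n)" G
    using n by (rule residue_ring_finite_comm_group_ring)
  have cl: "reduce_coeffs G n a \<in> carrier (Zn_group_ring n G)" for a
    by (auto simp: NG.carrier_group_ring reduce_coeffs_def)
  have "reduce_coeffs G n \<in> ring_hom \<int>G (Zn_group_ring n G)"
  proof (rule ring_hom_memI)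
    fix a b assume a: "a \<in> carrier \<int>G" and b: "b \<in> carrier \<int>G"
    show "reduce_coeffs G n (a \<otimes>\<^bsub>\<int>G\<^esub> b)
        = reduce_coeffs G n a \<otimes>\<^bsub>Zn_group_ring n G\<^esub> reduce_coeffs G n b"
    proof (rule NG.group_ring_eqI)
      fix g assume g: "g \<in> carrier G"
      have "(reduce_coeffs G n a \<otimes>\<^bsub>Zn_group_ring n G\<^esub> reduce_coeffs G n b) g
          = (\<Oplus>\<^bsub>residue_ring (int n)\<^esub>x\<in>carrier G. (a x * b (inv x \<otimes> g)) mod int n)"
        unfolding NG.group_ring_mult[OF cl cl g]
        using g by (intro N.finsum_cong') (auto simp: reduce_coeffs_def N.mult_cong)
      also have "\<dots> = reduce_coeffs G n (a \<otimes>\<^bsub>\<int>G\<^esub> b) g"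
        using g a b finite_carrier by (simp add: N.sum_cong reduce_coeffs_def ZG_mult_coeff)
      finally show "reduce_coeffs G n (a \<otimes>\<^bsub>\<int>G\<^esub> b) g
        = (reduce_coeffs G n a \<otimes>\<^bsub>Zn_group_ring n G\<^esub> reduce_coeffs G n b) g" ..
    qed (auto intro: cl NG.group_ring_closed)
    show "reduce_coeffs G n (a \<oplus>\<^bsub>\<int>G\<^esub> b)
        = reduce_coeffs G n a \<oplus>\<^bsub>Zn_group_ring n G\<^esub> reduce_coeffs G n b"
    proof (rule NG.group_ring_eqI)
      fix g assume "g \<in> carrier G"
      then show "reduce_coeffs G n (a \<oplus>\<^bsub>\<int>G\<^esub> b) g
        = (reduce_coeffs G n a \<oplus>\<^bsub>Zn_group_ring n G\<^esub> reduce_coeffs G n b) g"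
        by (simp add: NG.group_ring_add ZG_add_coeff reduce_coeffs_def N.add_cong)
    qed (auto intro: cl NG.group_ring_closed)
  next
    show "reduce_coeffs G n \<one>\<^bsub>\<int>G\<^esub> = \<one>\<^bsub>Zn_group_ring n G\<^esub>"
    proof (rule NG.group_ring_eqI)
      fix g assume "g \<in> carrier G"
      then show "reduce_coeffs G n \<one>\<^bsub>\<int>G\<^esub> g = \<one>\<^bsub>Zn_group_ring n G\<^esub> g"
        using n by (simp add: NG.group_ring_one Z.group_ring_one reduce_coeffs_def
                      N.res_one_eq N.res_zero_eq)
    qed (auto intro: cl NG.group_ring_zero_one_closed)
  qed (rule cl)
  then show ?thesis
    by (intro ring_hom_cring.intro ring_hom_cring_axioms.intro ZG.cring_axioms NG.cring_group_ring)
qed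

text \<open>
  Residues are themselves integers, so lifting idempotents to the integral group ring involves no
  choice of representatives.
\<close>

lemma reduce_coeffs_residues:
  assumes "n > 1" "a \<in> carrier (Zn_group_ring n G)"
  shows "a \<in> carrier \<int>G" "reduce_coeffs G n a = a"
proof -
  interpret N: residues "int n" "residue_ring (int n)"
    by unfold_locales (use assms in simp_all)
  interpret NG: finite_comm_group_ring "residue_ring (int n)" G
    using assms(1) by (rule residue_ring_finite_comm_group_ring)
  show "a \<in> carrier \<int>G" "reduce_coeffs G n a = a"
    using assms
    by (auto simp: ZG_carrier NG.carrier_group_ring PiE_def reduce_coeffs_def N.res_carrier_eq
          fun_eq_iff extensional_def Pi_def)
qed

lemma reduce_coeffs_in_idempotents_iff:
  assumes "n > 1" "a \<in> carrier \<int>G"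
  shows "reduce_coeffs G n a \<in> idempotents (Zn_group_ring n G)
     \<longleftrightarrow> reduce_coeffs G n (a \<otimes>\<^bsub>\<int>G\<^esub> a) = reduce_coeffs G n a"
proof -
  interpret H: ring_hom_cring "\<int>G" "Zn_group_ring n G" "reduce_coeffs G n"
    using assms(1) by (rule reduce_coeffs_ring_hom)
  show ?thesis using assms(2) by (simp add: idempotents_def)
qed

section \<open>Lifting and gluing idempotents\<close>

text \<open>
  An idempotent modulo \<open>P\<close> is a congruence between \<open>a\<^sup>2\<close> and \<open>a\<close>. Taking powers sharpens it, and the
  power of \<open>a\<^sup>2\<close> is the square of the power of \<open>a\<close> because the ring is commutative.
\<close>

lemma pow_lifts_idempotent:
  assumes "P > 1" "n > 1" "n dvd P ^ Suc s" and a: "a \<in> carrier \<int>G"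
    and idem: "reduce_coeffs G P a \<in> idempotents (Zn_group_ring P G)"
  shows "reduce_coeffs G n (a [^]\<^bsub>\<int>G\<^esub> (P ^ s)) \<in> idempotents (Zn_group_ring n G)"
proof -
  have "reduce_coeffs G P (a \<otimes>\<^bsub>\<int>G\<^esub> a) = reduce_coeffs G P a"
    using assms by (simp add: reduce_coeffs_in_idempotents_iff)
  then have "reduce_coeffs G n ((a \<otimes>\<^bsub>\<int>G\<^esub> a) [^]\<^bsub>\<int>G\<^esub> (P ^ s))
           = reduce_coeffs G n (a [^]\<^bsub>\<int>G\<^esub> (P ^ s))"
    using a assms(3) by (intro reduce_coeffs_eq_pow) auto
  then show ?thesis
    using a assms(2) by (simp add: reduce_coeffs_in_idempotents_iff ZG.nat_pow_distrib)
qed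

lemma reduce_coeffs_idempotent_pow:
  assumes "n > 1" "a \<in> carrier \<int>G" "reduce_coeffs G n a \<in> idempotents (Zn_group_ring n G)" "q > 0"
  shows "reduce_coeffs G n (a [^]\<^bsub>\<int>G\<^esub> (q::nat)) = reduce_coeffs G n a"
proof -
  interpret H: ring_hom_cring "\<int>G" "Zn_group_ring n G" "reduce_coeffs G n"
    using assms(1) by (rule reduce_coeffs_ring_hom)
  have "reduce_coeffs G n (a [^]\<^bsub>\<int>G\<^esub> q) = reduce_coeffs G n a [^]\<^bsub>Zn_group_ring n G\<^esub> q"
    using assms(2) by (simp add: H.ring.hom_nat_pow)
  then show ?thesis
    using assms by (simp add: idempotents_def H.S.idempotent_nat_pow)
qed

text \<open>
  The hypotheses on \<open>n\<close> say that \<open>n\<close> and \<open>P\<close> have the same radical, quantitatively: the kernel of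
  reduction is nilpotent, with exponent controlled by \<open>s\<close>. The inverse of the bijection is
  \<open>d \<mapsto> d ^ (P ^ s)\<close>, computed on integral lifts.
\<close>

lemma bij_betw_idempotents:
  assumes P: "P > 1" and n: "n > 1" and "P dvd n" "n dvd P ^ Suc s"
  shows "bij_betw (reduce_coeffs G P) (idempotents (Zn_group_ring n G))
           (idempotents (Zn_group_ring P G))"
  unfolding bij_betw_def
proof
  have P0: "P ^ s > 0" using P by simp
  have mod_P: "reduce_coeffs G P a = reduce_coeffs G P b"
    if "reduce_coeffs G n a = reduce_coeffs G n b" for a b
    using that assms(3) unfolding reduce_coeffs_eq_iff
    by (meson cong_dvd_modulus int_dvd_int_iff)
  show "inj_on (reduce_coeffs G P) (idempotents (Zn_group_ring n G))"
  proof (rule inj_onI)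
    fix d e
    assume de: "d \<in> idempotents (Zn_group_ring n G)" "e \<in> idempotents (Zn_group_ring n G)"
      and eq: "reduce_coeffs G P d = reduce_coeffs G P e"
    have *: "d \<in> carrier \<int>G" "e \<in> carrier \<int>G" "reduce_coeffs G n d = d" "reduce_coeffs G n e = e"
      using de reduce_coeffs_residues[OF n] by (auto simp: idempotents_def)
    have "d = reduce_coeffs G n (d [^]\<^bsub>\<int>G\<^esub> (P ^ s))"
      using de * n P0 by (simp add: reduce_coeffs_idempotent_pow)
    also have "\<dots> = reduce_coeffs G n (e [^]\<^bsub>\<int>G\<^esub> (P ^ s))"
      using eq assms(4) * by (intro reduce_coeffs_eq_pow) auto
    also have "\<dots> = e"
      using de * n P0 by (simp add: reduce_coeffs_idempotent_pow)
    finally show "d = e" .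
  qed
  show "reduce_coeffs G P ` idempotents (Zn_group_ring n G) = idempotents (Zn_group_ring P G)"
  proof
    show "reduce_coeffs G P ` idempotents (Zn_group_ring n G) \<subseteq> idempotents (Zn_group_ring P G)"
    proof clarify
      fix e assume e: "e \<in> idempotents (Zn_group_ring n G)"
      have *: "e \<in> carrier \<int>G" "reduce_coeffs G n e = e"
        using e reduce_coeffs_residues[OF n] by (auto simp: idempotents_def)
      then have "reduce_coeffs G n (e \<otimes>\<^bsub>\<int>G\<^esub> e) = reduce_coeffs G n e"
        using e n reduce_coeffs_in_idempotents_iff[OF n *(1)] by simp
      then show "reduce_coeffs G P e \<in> idempotents (Zn_group_ring P G)"
        using reduce_coeffs_in_idempotents_iff[OF P *(1)] mod_P by blast
    qed
    show "idempotents (Zn_group_ring P G) \<subseteq> reduce_coeffs G P ` idempotents (Zn_group_ring n G)"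
    proof
      fix d assume d: "d \<in> idempotents (Zn_group_ring P G)"
      have *: "d \<in> carrier \<int>G" "reduce_coeffs G P d = d"
        using d reduce_coeffs_residues[OF P] by (auto simp: idempotents_def)
      define e where "e = reduce_coeffs G n (d [^]\<^bsub>\<int>G\<^esub> (P ^ s))"
      have "e \<in> idempotents (Zn_group_ring n G)"
        unfolding e_def using * d assms by (intro pow_lifts_idempotent) auto
      moreover have "reduce_coeffs G n e = e"
        by (simp add: e_def reduce_coeffs_def fun_eq_iff)
      then have "reduce_coeffs G P e = reduce_coeffs G P (d [^]\<^bsub>\<int>G\<^esub> (P ^ s))"
        unfolding e_def by (rule mod_P)
      then have "reduce_coeffs G P e = d"
        using * d P P0 by (simp add: reduce_coeffs_idempotent_pow)
      ultimately show "d \<in> reduce_coeffs G P ` idempotents (Zn_group_ring n G)" by force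
    qed
  qed
qed

text \<open>
  The weights \<open>u i\<close> are the idempotents of the Chinese remainder theorem: modulo \<open>p i\<close> only the
  summand \<open>f i\<close> survives, so the sum has an idempotent reduction modulo every \<open>p i\<close>. The
  conclusion combines these congruences, coefficient by coefficient.
\<close>

lemma glued_idempotent:
  fixes p :: "'i \<Rightarrow> nat" and f :: "'i \<Rightarrow> 'a \<Rightarrow> int"
  assumes I: "finite I" "I \<noteq> {}"
    and p: "\<And>i. i \<in> I \<Longrightarrow> p i > 1"
    and coprime: "\<And>i l. i \<in> I \<Longrightarrow> l \<in> I \<Longrightarrow> i \<noteq> l \<Longrightarrow> coprime (p i) (p l)"
    and u1: "\<And>i. i \<in> I \<Longrightarrow> [u i = 1] (mod p i)"
    and u0: "\<And>i l. i \<in> I \<Longrightarrow> l \<in> I \<Longrightarrow> i \<noteq> l \<Longrightarrow> p i dvd u l"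
    and f: "\<And>i. i \<in> I \<Longrightarrow> f i \<in> carrier \<int>G"
    and idem: "\<And>i. i \<in> I \<Longrightarrow> reduce_coeffs G (p i) (f i) \<in> idempotents (Zn_group_ring (p i) G)"
  shows "reduce_coeffs G (\<Prod>i\<in>I. p i) (\<Oplus>\<^bsub>\<int>G\<^esub>i\<in>I. [u i] \<cdot>\<^bsub>\<int>G\<^esub> f i)
           \<in> idempotents (Zn_group_ring (\<Prod>i\<in>I. p i) G)"
proof -
  define S where "S = (\<Oplus>\<^bsub>\<int>G\<^esub>i\<in>I. [u i] \<cdot>\<^bsub>\<int>G\<^esub> f i)"
  have S: "S \<in> carrier \<int>G" using f by (auto simp: S_def)
  have idem_S: "reduce_coeffs G (p i) (S \<otimes>\<^bsub>\<int>G\<^esub> S) = reduce_coeffs G (p i) S" if i: "i \<in> I" for i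
  proof -
    have "reduce_coeffs G (p i) S = reduce_coeffs G (p i) (f i)"
      unfolding reduce_coeffs_eq_iff
    proof
      fix g assume g: "g \<in> carrier G"
      have "S g = (\<Sum>l\<in>I. int (u l) * f l g)"
        using f g by (simp add: S_def ZG_finsum_coeff ZG_add_pow_coeff)
      also have "[\<dots> = (\<Sum>l\<in>I. if l = i then f i g else 0)] (mod int (p i))"
      proof (rule cong_sum)
        fix l assume l: "l \<in> I"
        have "[int (u i) * f i g = 1 * f i g] (mod int (p i))"
          using u1[OF i] by (intro cong_mult cong_refl) (simp flip: cong_int_iff)
        then show "[int (u l) * f l g = (if l = i then f i g else 0)] (mod int (p i))"
          using u0[OF i l] by (auto simp: cong_0_iff)
      qed
      also have "(\<Sum>l\<in>I. if l = i then f i g else 0) = f i g"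
        using I i by simp
      finally show "[S g = f i g] (mod int (p i))" .
    qed
    then show ?thesis
      using reduce_coeffs_in_idempotents_iff[OF p[OF i]] S idem[OF i] by metis
  qed
  have "[(S \<otimes>\<^bsub>\<int>G\<^esub> S) g = S g] (mod int (\<Prod>i\<in>I. p i))" if g: "g \<in> carrier G" for g
    using idem_S coprime g unfolding of_nat_prod
    by (intro cong_cong_prod_coprime) (auto simp: reduce_coeffs_eq_iff)
  then have "reduce_coeffs G (\<Prod>i\<in>I. p i) (S \<otimes>\<^bsub>\<int>G\<^esub> S) = reduce_coeffs G (\<Prod>i\<in>I. p i) S"
    by (simp only: reduce_coeffs_eq_iff) blast
  moreover have "(\<Prod>i\<in>I. p i) > 1"
    using I p less_1_prod[of I "\<lambda>i. int (p i)"] by (simp flip: of_nat_prod)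
  ultimately show ?thesis
    using S by (simp only: S_def[symmetric] reduce_coeffs_in_idempotents_iff)
qed

end

section \<open>Idempotents modulo an integer and modulo its radical\<close>

theorem theorem4p12:
  fixes G :: "('g, 'h) monoid_scheme"
    and m j k :: nat
    and p r c :: "nat \<Rightarrow> nat"
  assumes "comm_group G" and "finite (carrier G)"
    and "m \<ge> 2"
    and "\<And>i. i \<in> {1..j} \<Longrightarrow> prime (p i)"
    and "inj_on p {1..j}"
    and "\<And>i. i \<in> {1..j} \<Longrightarrow> r i \<ge> 1"
    and "m = (\<Prod>i\<in>{1..j}. p i ^ r i)"
    and "k = Max (r ` {1..j})"
    and "\<And>i. i \<in> {1..j} \<Longrightarrow> c i = (\<Prod>l\<in>{1..j}. p l) div p i"
  shows "(\<forall>(t :: nat \<Rightarrow> nat) (fbar :: nat \<Rightarrow> 'g \<Rightarrow> int) (f :: nat \<Rightarrow> 'g \<Rightarrow> int).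
            (\<forall>i\<in>{1..j}. [t i * c i = 1] (mod p i)) \<longrightarrow>
            (\<forall>i\<in>{1..j}. fbar i \<in> idempotents (Zn_group_ring (p i) G)) \<longrightarrow>
            (\<forall>i\<in>{1..j}. f i \<in> carrier (group_ring \<Z> G) \<and> reduce_coeffs G (p i) (f i) = fbar i) \<longrightarrow>
            (\<Oplus>\<^bsub>Zn_group_ring m G\<^esub>i\<in>{1..j}.
                add_pow (Zn_group_ring m G) (t i * c i) (reduce_coeffs G m (f i)))
              [^]\<^bsub>Zn_group_ring m G\<^esub> ((\<Prod>i\<in>{1..j}. p i) ^ (k - 1))
            \<in> idempotents (Zn_group_ring m G))
       \<and> card (idempotents (Zn_group_ring m G))
           = card (idempotents (Zn_group_ring (\<Prod>i\<in>{1..j}. p i) G))"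
proof -
  interpret finite_comm_group G
    using assms(1,2) by (simp add: finite_comm_group_def finite_comm_group_axioms_def)
  define P where "P = (\<Prod>i\<in>{1..j}. p i)"
  have ne: "{1..j} \<noteq> {}"
  proof
    assume "{1..j} = {}"
    then show False using assms(3,7) by simp
  qed
  have p_gt: "p i > 1" if "i \<in> {1..j}" for i
    using assms(4)[OF that] by (rule prime_gt_1_nat)
  have P: "P > 1"
    using ne p_gt less_1_prod[of "{1..j}" "\<lambda>i. int (p i)"]
    unfolding P_def by (simp flip: of_nat_prod)
  have m: "m > 1" using assms(3) by simp
  have r_le: "r i \<le> k" if "i \<in> {1..j}" for i
    using that by (simp add: assms(8))
  \<comment> \<open>The prime factorization is non-empty with positive exponents, so \<open>k - 1\<close> is not truncated.\<close>
  have k: "Suc (k - 1) = k"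
    using ne r_le assms(6) by fastforce
  have P_dvd: "P dvd m"
    unfolding P_def assms(7) using assms(6) by (intro prod_dvd_prod) (force intro: dvd_power)
  have dvd_Pk: "m dvd P ^ Suc (k - 1)"
    unfolding k P_def assms(7) prod_power_distrib
    by (intro prod_dvd_prod le_imp_power_dvd r_le)
  have coprime: "coprime (p i) (p l)" if "i \<in> {1..j}" "l \<in> {1..j}" "i \<noteq> l" for i l
    using that assms(4,5) by (intro primes_coprime) (auto dest: inj_onD)
  have p_dvd_c: "p i dvd c l" if "i \<in> {1..j}" "l \<in> {1..j}" "i \<noteq> l" for i l
  proof -
    have "(\<Prod>i\<in>{1..j}. p i) = p l * (\<Prod>i\<in>{1..j} - {l}. p i)"
      using that by (intro prod.remove) auto
    then have "c l = (\<Prod>i\<in>{1..j} - {l}. p i)"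
      using assms(9)[OF that(2)] p_gt[OF that(2)] by simp
    then show ?thesis using that by (simp add: dvd_prodI)
  qed
  interpret H: ring_hom_cring "\<int>G" "Zn_group_ring m G" "reduce_coeffs G m"
    using m by (rule reduce_coeffs_ring_hom)
  have hom_add_pow: "reduce_coeffs G m ([n] \<cdot>\<^bsub>\<int>G\<^esub> a)
      = [n] \<cdot>\<^bsub>Zn_group_ring m G\<^esub> reduce_coeffs G m a" if "a \<in> carrier \<int>G" for n :: nat and a
    using that by (induction n) simp_all
  show ?thesis
    unfolding P_def[symmetric]
  proof (intro conjI allI impI)
    fix t :: "nat \<Rightarrow> nat" and fbar f :: "nat \<Rightarrow> 'g \<Rightarrow> int"
    assume t: "\<forall>i\<in>{1..j}. [t i * c i = 1] (mod p i)"
      and fbar: "\<forall>i\<in>{1..j}. fbar i \<in> idempotents (Zn_group_ring (p i) G)"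
      and f: "\<forall>i\<in>{1..j}. f i \<in> carrier \<int>G \<and> reduce_coeffs G (p i) (f i) = fbar i"
    define S where "S = (\<Oplus>\<^bsub>\<int>G\<^esub>i\<in>{1..j}. [(t i * c i)] \<cdot>\<^bsub>\<int>G\<^esub> f i)"
    have S: "S \<in> carrier \<int>G" using f by (auto simp: S_def)
    have "reduce_coeffs G P S \<in> idempotents (Zn_group_ring P G)"
      unfolding S_def P_def using ne p_gt coprime t p_dvd_c f fbar
      by (intro glued_idempotent) auto
    then have "reduce_coeffs G m (S [^]\<^bsub>\<int>G\<^esub> (P ^ (k - 1))) \<in> idempotents (Zn_group_ring m G)"
      using P m dvd_Pk S by (intro pow_lifts_idempotent)
    moreover have "reduce_coeffs G m S
        = (\<Oplus>\<^bsub>Zn_group_ring m G\<^esub>i\<in>{1..j}.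
             [(t i * c i)] \<cdot>\<^bsub>Zn_group_ring m G\<^esub> reduce_coeffs G m (f i))"
      unfolding S_def using f
      by (subst H.hom_finsum) (auto intro!: H.S.finsum_cong' simp: hom_add_pow)
    ultimately show "(\<Oplus>\<^bsub>Zn_group_ring m G\<^esub>i\<in>{1..j}.
                add_pow (Zn_group_ring m G) (t i * c i) (reduce_coeffs G m (f i)))
              [^]\<^bsub>Zn_group_ring m G\<^esub> (P ^ (k - 1)) \<in> idempotents (Zn_group_ring m G)"
      using S by (simp add: H.ring.hom_nat_pow)
  next
    show "card (idempotents (Zn_group_ring m G)) = card (idempotents (Zn_group_ring P G))"
      using bij_betw_idempotents[OF P m P_dvd dvd_Pk] by (rule bij_betw_same_card)
  qed
qed

end
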